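(* Let $R$ be a commutative semiring, $M$ an $R$-semimodule, and let $\mathrm{Dis}_M$ be a subsemimodule space (for any one of the distinguished classes of subsemimodules of $M$). Suppose that $\mathrm{Dis}_M$ is a compact space. Then $\mathrm{Dis}_M$ is disconnected if and only if the closed basis of $\mathrm{Dis}_M$ (consisting of the finite unions of sets $\mathcal V(N)$, $N\in\mathrm{Sub}_M$) strongly disconnects $\mathrm{Dis}_M$.
   Context: A (commutative) semiring is $(R,+,0,\cdot,1)$ with $(R,+,0)$ and $(R,\cdot,1)$ commutative monoids, $0r=0=r0$ for all $r$, and $\cdot$ distributing over $+$. An $R$-semimodule $M$ is an additive commutative monoid with a scalar multiplication $R\times M\to M$ satisfying $(r+r')m=rm+r'm$, $r(m+m')=rm+rm'$, $(rr')m=r(r'm)$, $1m=m$, $r0=0=0m$. A subsemimodule of $M$ is a nonempty subset closed under addition and scalar multiplication; $\mathrm{Sub}_M$ is the set of all of them. Write $(N:M)=\{r\in R\mid rM\subseteq N\}$. Distinguished classes. A subsemimodule $N$ of $M$ is: subtractive if $x+y\in N$ and $x\in N$ imply $y\in N$; strong if $x+y\in N$ implies $x,y\in N$; proper if $N\ne M$; maximal if $N$ is proper and no other proper subsemimodule contains $N$; prime if $N$ is proper and $rm\in N$ ($r\in R$, $m\in M$) implies $m\in N$ or $r\in (N:M)$; primary if $N$ is proper and $rm\in N$ implies $m\in N$ or $r^n\in (N:M)$ for some $n\in\mathbb N$; weakly prime if $N$ is proper and $0\ne rm\in N$ implies $m\in N$ or $rM\subseteq N$; primal if $N$ is proper and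 $R\setminus \mathrm{Prm}(N)$ is an ideal of $R$, where $\mathrm{Prm}(N)$ is the set of $r\in R$ such that, for all $m\in M$, $rm\in N$ implies $m\in N$; semiprime if $N$ is an intersection of prime subsemimodules of $M$; extraordinary if $N$ is prime and for all semiprime subsemimodules $L,K$, $L\cap K\subseteq N$ implies $L\subseteq N$ or $K\subseteq N$; strongly irreducible if for all subsemimodules $L,K$, $L\cap K\subseteq N$ implies $L\subseteq N$ or $K\subseteq N$; irreducible (completely irreducible) if $N$ is not the intersection of two (of any set of) subsemimodules of $M$ in which $N$ is properly contained; cyclic (finitely generated) if $N$ is generated by one element (by a finite set of elements); minimal if $N\neq 0$ and $N$ contains no other nonzero subsemimodule; minimal prime if $N$ is both minimal and prime. $\mathrm{Dis}_M$ denotes the set of all subsemimodules of $M$ of any one of these types, with the convention $M\notin \mathrm{Dis}_M$. For $N\in\mathrm{Sub}_M$ put $\mathcal V(N)=\{L\in\mathrm{Dis}_M\mid N\subseteq L\}$. The topology on $\mathrm{Dis}_M$ is the one having $\{\mathcal V(N)\}_{N\in \mathrm{Sub}_M}$ as a closed subbasis (closed sets are arbitrary intersections of finite unions of sets $\mathcal V(N)$); $\mathrm{Dis}_M$ with this topology is called a subsemimodule space. Compact means every open cover has a finite subcover (no Hausdorff condition). A closed subbasis $\mathcal S$ of a topological space $X$ (in particular, a closed basis) is said to strongly disconnect $X$ if there exist two non-empty sets $A,B\in\mathcal S$ such that $X=A\cup B$ and $A\cap B=\emptyset$. *)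

theory Defs
  imports "HOL-Algebra.Module" "HOL-Analysis.Abstract_Topology"
begin

section \<open>Semimodules over commutative semirings\<close>

locale csemiring = semiring R + comm_monoid R for R (structure)

locale semimodule = R?: csemiring R + M?: abelian_monoid M
  for R :: "('r, 'x) ring_scheme" (structure) and M :: "('r, 'm, 'y) module_scheme" (structure) +
  assumes smult_closed:
      "\<lbrakk>r \<in> carrier R; m \<in> carrier M\<rbrakk> \<Longrightarrow> r \<odot>\<^bsub>M\<^esub> m \<in> carrier M"
    and smult_l_distr:
      "\<lbrakk>r \<in> carrier R; r' \<in> carrier R; m \<in> carrier M\<rbrakk>
        \<Longrightarrow> (r \<oplus>\<^bsub>R\<^esub> r') \<odot>\<^bsub>M\<^esub> m = (r \<odot>\<^bsub>M\<^esub> m) \<oplus>\<^bsub>M\<^esub> (r' \<odot>\<^bsub>M\<^esub> m)"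
    and smult_r_distr:
      "\<lbrakk>r \<in> carrier R; m \<in> carrier M; m' \<in> carrier M\<rbrakk>
        \<Longrightarrow> r \<odot>\<^bsub>M\<^esub> (m \<oplus>\<^bsub>M\<^esub> m') = (r \<odot>\<^bsub>M\<^esub> m) \<oplus>\<^bsub>M\<^esub> (r \<odot>\<^bsub>M\<^esub> m')"
    and smult_assoc:
      "\<lbrakk>r \<in> carrier R; r' \<in> carrier R; m \<in> carrier M\<rbrakk>
        \<Longrightarrow> (r \<otimes>\<^bsub>R\<^esub> r') \<odot>\<^bsub>M\<^esub> m = r \<odot>\<^bsub>M\<^esub> (r' \<odot>\<^bsub>M\<^esub> m)"
    and smult_one: "m \<in> carrier M \<Longrightarrow> \<one>\<^bsub>R\<^esub> \<odot>\<^bsub>M\<^esub> m = m"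
    and smult_r_null: "r \<in> carrier R \<Longrightarrow> r \<odot>\<^bsub>M\<^esub> \<zero>\<^bsub>M\<^esub> = \<zero>\<^bsub>M\<^esub>"
    and smult_l_null: "m \<in> carrier M \<Longrightarrow> \<zero>\<^bsub>R\<^esub> \<odot>\<^bsub>M\<^esub> m = \<zero>\<^bsub>M\<^esub>"

definition semiring_ideal :: "('r, 'x) ring_scheme \<Rightarrow> 'r set \<Rightarrow> bool" where
  "semiring_ideal R I \<longleftrightarrow> I \<subseteq> carrier R \<and> I \<noteq> {} \<and>
     (\<forall>x\<in>I. \<forall>y\<in>I. x \<oplus>\<^bsub>R\<^esub> y \<in> I) \<and> (\<forall>r\<in>carrier R. \<forall>x\<in>I. r \<otimes>\<^bsub>R\<^esub> x \<in> I)"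

definition Sub :: "('r, 'x) ring_scheme \<Rightarrow> ('r, 'm, 'y) module_scheme \<Rightarrow> 'm set set" where
  "Sub R M = {N. N \<subseteq> carrier M \<and> N \<noteq> {} \<and>
     (\<forall>x\<in>N. \<forall>y\<in>N. x \<oplus>\<^bsub>M\<^esub> y \<in> N) \<and> (\<forall>r\<in>carrier R. \<forall>x\<in>N. r \<odot>\<^bsub>M\<^esub> x \<in> N)}"

definition colon ::
    "('r, 'x) ring_scheme \<Rightarrow> ('r, 'm, 'y) module_scheme \<Rightarrow> 'm set \<Rightarrow> 'r set" where
  "colon R M N = {r \<in> carrier R. \<forall>m\<in>carrier M. r \<odot>\<^bsub>M\<^esub> m \<in> N}"

definition Prm ::
    "('r, 'x) ring_scheme \<Rightarrow> ('r, 'm, 'y) module_scheme \<Rightarrow> 'm set \<Rightarrow> 'r set" where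
  "Prm R M N = {r \<in> carrier R. \<forall>m\<in>carrier M. r \<odot>\<^bsub>M\<^esub> m \<in> N \<longrightarrow> m \<in> N}"


section \<open>The distinguished classes of subsemimodules\<close>

definition proper_sub ::
    "('r, 'x) ring_scheme \<Rightarrow> ('r, 'm, 'y) module_scheme \<Rightarrow> 'm set \<Rightarrow> bool" where
  "proper_sub R M N \<longleftrightarrow> N \<in> Sub R M \<and> N \<noteq> carrier M"

definition prime_sub ::
    "('r, 'x) ring_scheme \<Rightarrow> ('r, 'm, 'y) module_scheme \<Rightarrow> 'm set \<Rightarrow> bool" where
  "prime_sub R M N \<longleftrightarrow> proper_sub R M N \<and>
     (\<forall>r\<in>carrier R. \<forall>m\<in>carrier M. r \<odot>\<^bsub>M\<^esub> m \<in> N \<longrightarrow> m \<in> N \<or> r \<in> colon R M N)"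

text \<open>Intersections of families of subsemimodules are taken inside \<open>M\<close>, so that the empty
  family has intersection \<open>M\<close>.\<close>

definition semiprime_sub ::
    "('r, 'x) ring_scheme \<Rightarrow> ('r, 'm, 'y) module_scheme \<Rightarrow> 'm set \<Rightarrow> bool" where
  "semiprime_sub R M N \<longleftrightarrow> (\<exists>\<F>. (\<forall>P\<in>\<F>. prime_sub R M P) \<and> N = carrier M \<inter> \<Inter>\<F>)"

definition minimal_sub ::
    "('r, 'x) ring_scheme \<Rightarrow> ('r, 'm, 'y) module_scheme \<Rightarrow> 'm set \<Rightarrow> bool" where
  "minimal_sub R M N \<longleftrightarrow> N \<in> Sub R M \<and> N \<noteq> {\<zero>\<^bsub>M\<^esub>} \<and>
     (\<forall>L\<in>Sub R M. L \<subseteq> N \<longrightarrow> L \<noteq> {\<zero>\<^bsub>M\<^esub>} \<longrightarrow> L = N)"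

definition generated_sub ::
    "('r, 'x) ring_scheme \<Rightarrow> ('r, 'm, 'y) module_scheme \<Rightarrow> 'm set \<Rightarrow> 'm set" where
  "generated_sub R M S = (\<lambda>L. L \<in> Sub R M) hull S"

datatype sub_class =
    Subtractive | Strong | Proper | Maximal | Prime | Primary | Weakly_Prime | Primal
  | Semiprime | Extraordinary | Strongly_Irreducible | Irreducible | Completely_Irreducible
  | Cyclic | Finitely_Generated | Minimal | Minimal_Prime

fun in_class ::
    "sub_class \<Rightarrow> ('r, 'x) ring_scheme \<Rightarrow> ('r, 'm, 'y) module_scheme \<Rightarrow> 'm set \<Rightarrow> bool" where
  "in_class Subtractive R M N \<longleftrightarrow> N \<in> Sub R M \<and>
     (\<forall>x\<in>carrier M. \<forall>y\<in>carrier M. x \<oplus>\<^bsub>M\<^esub> y \<in> N \<and> x \<in> N \<longrightarrow> y \<in> N)"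
| "in_class Strong R M N \<longleftrightarrow> N \<in> Sub R M \<and>
     (\<forall>x\<in>carrier M. \<forall>y\<in>carrier M. x \<oplus>\<^bsub>M\<^esub> y \<in> N \<longrightarrow> x \<in> N \<and> y \<in> N)"
| "in_class Proper R M N \<longleftrightarrow> proper_sub R M N"
| "in_class Maximal R M N \<longleftrightarrow> proper_sub R M N \<and>
     (\<forall>L. proper_sub R M L \<and> N \<subseteq> L \<longrightarrow> L = N)"
| "in_class Prime R M N \<longleftrightarrow> prime_sub R M N"
| "in_class Primary R M N \<longleftrightarrow> proper_sub R M N \<and>
     (\<forall>r\<in>carrier R. \<forall>m\<in>carrier M. r \<odot>\<^bsub>M\<^esub> m \<in> N \<longrightarrow>
        m \<in> N \<or> (\<exists>n::nat. r [^]\<^bsub>R\<^esub> n \<in> colon R M N))"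
| "in_class Weakly_Prime R M N \<longleftrightarrow> proper_sub R M N \<and>
     (\<forall>r\<in>carrier R. \<forall>m\<in>carrier M. r \<odot>\<^bsub>M\<^esub> m \<noteq> \<zero>\<^bsub>M\<^esub> \<and> r \<odot>\<^bsub>M\<^esub> m \<in> N \<longrightarrow>
        m \<in> N \<or> r \<in> colon R M N)"
| "in_class Primal R M N \<longleftrightarrow> proper_sub R M N \<and> semiring_ideal R (carrier R - Prm R M N)"
| "in_class Semiprime R M N \<longleftrightarrow> semiprime_sub R M N"
| "in_class Extraordinary R M N \<longleftrightarrow> prime_sub R M N \<and>
     (\<forall>L K. semiprime_sub R M L \<and> semiprime_sub R M K \<and> L \<inter> K \<subseteq> N \<longrightarrow> L \<subseteq> N \<or> K \<subseteq> N)"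
| "in_class Strongly_Irreducible R M N \<longleftrightarrow> N \<in> Sub R M \<and>
     (\<forall>L\<in>Sub R M. \<forall>K\<in>Sub R M. L \<inter> K \<subseteq> N \<longrightarrow> L \<subseteq> N \<or> K \<subseteq> N)"
| "in_class Irreducible R M N \<longleftrightarrow> N \<in> Sub R M \<and>
     \<not> (\<exists>L\<in>Sub R M. \<exists>K\<in>Sub R M. N \<subset> L \<and> N \<subset> K \<and> N = L \<inter> K)"
| "in_class Completely_Irreducible R M N \<longleftrightarrow> N \<in> Sub R M \<and>
     \<not> (\<exists>\<F> \<subseteq> Sub R M. (\<forall>L\<in>\<F>. N \<subset> L) \<and> N = carrier M \<inter> \<Inter>\<F>)"
| "in_class Cyclic R M N \<longleftrightarrow> (\<exists>x\<in>carrier M. N = generated_sub R M {x})"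
| "in_class Finitely_Generated R M N \<longleftrightarrow>
     (\<exists>S. finite S \<and> S \<subseteq> carrier M \<and> N = generated_sub R M S)"
| "in_class Minimal R M N \<longleftrightarrow> minimal_sub R M N"
| "in_class Minimal_Prime R M N \<longleftrightarrow> minimal_sub R M N \<and> prime_sub R M N"

definition Dis ::
    "sub_class \<Rightarrow> ('r, 'x) ring_scheme \<Rightarrow> ('r, 'm, 'y) module_scheme \<Rightarrow> 'm set set" where
  "Dis c R M = {N \<in> Sub R M. in_class c R M N \<and> N \<noteq> carrier M}"


section \<open>Subsemimodule spaces\<close>

definition V ::
    "sub_class \<Rightarrow> ('r, 'x) ring_scheme \<Rightarrow> ('r, 'm, 'y) module_scheme \<Rightarrow> 'm set \<Rightarrow> 'm set set" where
  "V c R M N = {L \<in> Dis c R M. N \<subseteq> L}"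

definition subsemimodule_space ::
    "sub_class \<Rightarrow> ('r, 'x) ring_scheme \<Rightarrow> ('r, 'm, 'y) module_scheme \<Rightarrow> 'm set topology" where
  "subsemimodule_space c R M = topology_generated_by ((\<lambda>N. Dis c R M - V c R M N) ` Sub R M)"

definition finite_unions :: "'a set set \<Rightarrow> 'a set set" where
  "finite_unions \<S> = {\<Union>\<G> |\<G>. finite \<G> \<and> \<G> \<subseteq> \<S>}"

definition closed_basis ::
    "sub_class \<Rightarrow> ('r, 'x) ring_scheme \<Rightarrow> ('r, 'm, 'y) module_scheme \<Rightarrow> 'm set set set" where
  "closed_basis c R M = finite_unions (V c R M ` Sub R M)"

definition strongly_disconnects :: "'a set set \<Rightarrow> 'a topology \<Rightarrow> bool" where
  "strongly_disconnects \<S> X \<longleftrightarrow>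
     (\<exists>A\<in>\<S>. \<exists>B\<in>\<S>. A \<noteq> {} \<and> B \<noteq> {} \<and> topspace X = A \<union> B \<and> A \<inter> B = {})"

text \<open>The library generates topologies from open subbases. The next facts confirm that the
  complements of the \<open>V c R M N\<close> give the topology whose closed sets are the arbitrary
  intersections, inside \<open>Dis c R M\<close>, of finite unions of sets \<open>V c R M N\<close>.\<close>

lemma (in semimodule) carrier_in_Sub: "carrier M \<in> Sub R M"
  using M.zero_closed by (auto simp: Sub_def smult_closed)

lemma V_carrier: "V c R M (carrier M) = {}"
  by (auto simp: V_def Dis_def Sub_def)

lemma (in semimodule) topspace_subsemimodule_space:
  "topspace (subsemimodule_space c R M) = Dis c R M"
proof -
  have "Dis c R M - V c R M (carrier M) = Dis c R M"
    by (simp add: V_carrier)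
  then show ?thesis
    using carrier_in_Sub by (auto simp: subsemimodule_space_def)
qed

lemma finite_unions_Un:
  "A \<in> finite_unions \<S> \<Longrightarrow> B \<in> finite_unions \<S> \<Longrightarrow> A \<union> B \<in> finite_unions \<S>"
proof -
  assume "A \<in> finite_unions \<S>" "B \<in> finite_unions \<S>"
  then obtain F G where "finite F" "F \<subseteq> \<S>" "A = \<Union>F" "finite G" "G \<subseteq> \<S>" "B = \<Union>G"
    unfolding finite_unions_def by blast
  then have "finite (F \<union> G)" "F \<union> G \<subseteq> \<S>" "A \<union> B = \<Union>(F \<union> G)" by auto
  then show ?thesis
    unfolding finite_unions_def by blast
qed

lemma (in semimodule) closedin_subsemimodule_space:
  "closedin (subsemimodule_space c R M) C \<longleftrightarrow>
     (\<exists>\<F> \<subseteq> closed_basis c R M. C = Dis c R M \<inter> \<Inter>\<F>)"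
proof
  let ?D = "Dis c R M" and ?B = "closed_basis c R M"
  let ?P = "\<lambda>C. \<exists>\<F> \<subseteq> ?B. C = ?D \<inter> \<Inter>\<F>"
  have gen: "?P (?D - U)"
    if "generate_topology_on ((\<lambda>N. ?D - V c R M N) ` Sub R M) U" for U
    using that
  proof induction
    case Empty
    show ?case by (rule exI[of _ "{}"]) simp
  next
    case (Int a b)
    then obtain F G where F: "F \<subseteq> ?B" "?D - a = ?D \<inter> \<Inter>F"
      and G: "G \<subseteq> ?B" "?D - b = ?D \<inter> \<Inter>G" by blast
    have "(\<lambda>(A, B). A \<union> B) ` (F \<times> G) \<subseteq> ?B"
      using F(1) G(1) by (auto simp: closed_basis_def intro!: finite_unions_Un)
    moreover have "?D - a \<inter> b = ?D \<inter> \<Inter>((\<lambda>(A, B). A \<union> B) ` (F \<times> G))"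
    proof -
      have "?D - a \<inter> b = (?D \<inter> \<Inter>F) \<union> (?D \<inter> \<Inter>G)" using F G by blast
      also have "\<dots> = ?D \<inter> (\<Inter>F \<union> \<Inter>G)" by blast
      also have "\<Inter>F \<union> \<Inter>G = \<Inter>((\<lambda>(A, B). A \<union> B) ` (F \<times> G))"
        by (auto simp: Inter_Un_distrib split: prod.splits)
      finally show ?thesis .
    qed
    ultimately show ?case by blast
  next
    case (UN K)
    then obtain f where f: "\<And>k. k \<in> K \<Longrightarrow> f k \<subseteq> ?B \<and> ?D - k = ?D \<inter> \<Inter>(f k)"
      by metis
    have "\<Union>(f ` K) \<subseteq> ?B" using f by blast
    moreover have "?D - \<Union>K = ?D \<inter> \<Inter>(\<Union>(f ` K))"
    proof -
      have "?D - \<Union>K = ?D \<inter> (\<Inter>k\<in>K. ?D - k)" by auto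
      also have "(\<Inter>k\<in>K. ?D - k) = (\<Inter>k\<in>K. ?D \<inter> \<Inter>(f k))"
        using f by (intro INF_cong) auto
      also have "?D \<inter> \<dots> = ?D \<inter> \<Inter>(\<Union>(f ` K))" by auto
      finally show ?thesis .
    qed
    ultimately show ?case by blast
  next
    case (Basis s)
    then obtain N where N: "N \<in> Sub R M" "s = ?D - V c R M N" by blast
    have "V c R M N \<in> ?B"
      unfolding closed_basis_def finite_unions_def using N
      by (auto intro!: exI[of _ "{V c R M N}"])
    moreover have "?D - s = ?D \<inter> \<Inter>{V c R M N}" using N by (auto simp: V_def)
    ultimately show ?case by blast
  qed
  {
    assume "closedin (subsemimodule_space c R M) C"
    then have "C \<subseteq> ?D" "openin (subsemimodule_space c R M) (?D - C)"
      by (auto simp: closedin_def topspace_subsemimodule_space)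
    then show "?P C"
      using gen[of "?D - C"]
      by (simp add: subsemimodule_space_def openin_topology_generated_by_iff double_diff)
  }
  {
    assume "?P C"
    then obtain F where F: "F \<subseteq> ?B" "C = ?D \<inter> \<Inter>F" by blast
    have V: "closedin (subsemimodule_space c R M) (V c R M N)" if "N \<in> Sub R M" for N
      using that unfolding closedin_def topspace_subsemimodule_space
      by (auto simp: subsemimodule_space_def V_def intro!: topology_generated_by_Basis)
    have "closedin (subsemimodule_space c R M) A" if "A \<in> F" for A
      using that F(1) V by (auto simp: closed_basis_def finite_unions_def intro!: closedin_Union)
    moreover have "closedin (subsemimodule_space c R M) ?D"
      using closedin_topspace[of "subsemimodule_space c R M"]
      by (simp add: topspace_subsemimodule_space)
    ultimately have "closedin (subsemimodule_space c R M) (\<Inter>(insert ?D F))"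
      by (intro closedin_Inter) auto
    then show "closedin (subsemimodule_space c R M) C" using F(2) by simp
  }
qed

end

theory Submission
  imports Defs
begin

text \<open>
  If the closed basis strongly disconnects the space, the two basis sets form a separation by
  closed sets. Conversely, each half of a separation is clopen, and in a compact space a clopen set
  belongs to every closed basis that is stable under finite intersections
  (\<open>clopen_in_closed_basis\<close>): it is an intersection of basis sets, and finitely many of these
  suffice because its complement is compact.

  What remains is that the finite unions of sets \<open>\<V>(N)\<close> are stable under finite intersections.
  This holds because \<open>\<V>(N) \<inter> \<V>(L) = \<V>(N + L)\<close> (\<open>V_Int_V\<close>), where \<open>N + L\<close> is the subsemimodule generated
  by \<open>N \<union> L\<close>, while the empty intersection, the whole space, is \<open>\<V>(0)\<close>.
\<close>

lemma finite_Inter_in: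
  assumes "finite \<F>" and "\<F> \<subseteq> \<B>" and "T \<in> \<B>"
    and "\<And>A B. A \<in> \<B> \<Longrightarrow> B \<in> \<B> \<Longrightarrow> A \<inter> B \<in> \<B>"
  shows "T \<inter> \<Inter>\<F> \<in> \<B>"
  using assms(1,2)
proof induction
  case empty
  then show ?case using assms(3) by simp
next
  case (insert A \<F>)
  then have "A \<inter> (T \<inter> \<Inter>\<F>) \<in> \<B>" using assms(4) by simp
  moreover have "A \<inter> (T \<inter> \<Inter>\<F>) = T \<inter> \<Inter>(insert A \<F>)" by blast
  ultimately show ?case by simp
qed

text \<open>The complement of a clopen set is compact, and the complements of the basis sets that cut out
  the clopen set cover it. A finite subcover exhibits the clopen set as a finite intersection of
  basis sets.\<close>

lemma clopen_in_closed_basis: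
  assumes "compact_space X" and "openin X C" and "closedin X C"
    and closed: "\<And>B. B \<in> \<B> \<Longrightarrow> closedin X B"
    and basis: "\<And>A. closedin X A \<Longrightarrow> \<exists>\<F>\<subseteq>\<B>. A = topspace X \<inter> \<Inter>\<F>"
    and top: "topspace X \<in> \<B>"
    and Int: "\<And>A B. A \<in> \<B> \<Longrightarrow> B \<in> \<B> \<Longrightarrow> A \<inter> B \<in> \<B>"
  shows "C \<in> \<B>"
proof -
  obtain \<F> where \<F>: "\<F> \<subseteq> \<B>" "C = topspace X \<inter> \<Inter>\<F>"
    using basis assms(3) by blast
  have "compactin X (topspace X - C)"
    using assms(1,2) by (intro closedin_compact_space) auto
  moreover have "openin X U" if "U \<in> (\<lambda>B. topspace X - B) ` \<F>" for U
    using that \<F>(1) closed by blast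
  moreover have "topspace X - C \<subseteq> \<Union>((\<lambda>B. topspace X - B) ` \<F>)"
    using \<F>(2) by blast
  ultimately obtain \<U> where \<U>: "finite \<U>" "\<U> \<subseteq> (\<lambda>B. topspace X - B) ` \<F>" "topspace X - C \<subseteq> \<Union>\<U>"
    by (meson compactinD)
  then obtain \<G> where \<G>: "\<G> \<subseteq> \<F>" "finite \<G>" "\<U> = (\<lambda>B. topspace X - B) ` \<G>"
    by (meson finite_subset_image)
  have "C = topspace X \<inter> \<Inter>\<G>"
  proof
    show "C \<subseteq> topspace X \<inter> \<Inter>\<G>" using \<F>(2) \<G>(1) by blast
    show "topspace X \<inter> \<Inter>\<G> \<subseteq> C" using \<U>(3) \<G>(3) by blast
  qed
  then show ?thesis
    using finite_Inter_in[OF \<G>(2) _ top Int] \<F>(1) \<G>(1) by blast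
qed

lemma finite_unions_Int:
  assumes "\<And>S T. S \<in> \<S> \<Longrightarrow> T \<in> \<S> \<Longrightarrow> S \<inter> T \<in> \<S>"
    and "A \<in> finite_unions \<S>" and "B \<in> finite_unions \<S>"
  shows "A \<inter> B \<in> finite_unions \<S>"
proof -
  obtain F G where "finite F" "F \<subseteq> \<S>" "A = \<Union>F" "finite G" "G \<subseteq> \<S>" "B = \<Union>G"
    using assms(2,3) unfolding finite_unions_def by blast
  then have "finite ((\<lambda>(S, T). S \<inter> T) ` (F \<times> G))" "(\<lambda>(S, T). S \<inter> T) ` (F \<times> G) \<subseteq> \<S>"
    and "A \<inter> B = \<Union>((\<lambda>(S, T). S \<inter> T) ` (F \<times> G))"
    using assms(1) by auto
  then show ?thesis
    unfolding finite_unions_def by blast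
qed

lemma in_finite_unions: "A \<in> \<S> \<Longrightarrow> A \<in> finite_unions \<S>"
  unfolding finite_unions_def by (auto intro!: exI[of _ "{A}"])

context semimodule
begin

lemma zero_in_Sub:
  assumes "N \<in> Sub R M"
  shows "\<zero>\<^bsub>M\<^esub> \<in> N"
proof -
  obtain x where "x \<in> N" "x \<in> carrier M" using assms unfolding Sub_def by blast
  then show ?thesis
    using assms smult_l_null[of x] unfolding Sub_def by force
qed

lemma zero_subsemimodule: "{\<zero>\<^bsub>M\<^esub>} \<in> Sub R M"
  by (auto simp: Sub_def smult_r_null)

text \<open>Subsemimodules are required to be nonempty; an intersection of them stays nonempty because
  they share the element zero.\<close>

lemma generated_sub_in_Sub:
  assumes "S \<subseteq> carrier M"
  shows "generated_sub R M S \<in> Sub R M"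
proof -
  have "generated_sub R M S \<subseteq> carrier M"
    using assms carrier_in_Sub unfolding generated_sub_def by (intro hull_minimal)
  moreover have "\<zero>\<^bsub>M\<^esub> \<in> generated_sub R M S"
    unfolding generated_sub_def hull_def using zero_in_Sub by blast
  moreover have "x \<oplus>\<^bsub>M\<^esub> y \<in> generated_sub R M S"
    if "x \<in> generated_sub R M S" "y \<in> generated_sub R M S" for x y
    using that by (auto simp: generated_sub_def hull_def Sub_def)
  moreover have "r \<odot>\<^bsub>M\<^esub> x \<in> generated_sub R M S"
    if "r \<in> carrier R" "x \<in> generated_sub R M S" for r x
    using that by (auto simp: generated_sub_def hull_def Sub_def)
  ultimately show ?thesis
    unfolding Sub_def by blast
qed

lemma V_Int_V: "V c R M N \<inter> V c R M L = V c R M (generated_sub R M (N \<union> L))"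
proof -
  have "generated_sub R M (N \<union> L) \<subseteq> K \<longleftrightarrow> N \<union> L \<subseteq> K" if "K \<in> Sub R M" for K
    using that hull_minimal[of "N \<union> L" K "\<lambda>L. L \<in> Sub R M"]
      hull_subset[of "N \<union> L" "\<lambda>L. L \<in> Sub R M"]
    unfolding generated_sub_def by blast
  then show ?thesis
    by (auto simp: V_def Dis_def)
qed

lemma V_zero: "V c R M {\<zero>\<^bsub>M\<^esub>} = Dis c R M"
  using zero_in_Sub by (auto simp: V_def Dis_def)

lemma Dis_in_closed_basis: "Dis c R M \<in> closed_basis c R M"
  unfolding closed_basis_def using zero_subsemimodule V_zero
  by (metis imageI in_finite_unions)

lemma closed_basis_Int:
  assumes "A \<in> closed_basis c R M" and "B \<in> closed_basis c R M"
  shows "A \<inter> B \<in> closed_basis c R M"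
  using assms unfolding closed_basis_def
proof (rule finite_unions_Int[rotated])
  fix S T assume "S \<in> V c R M ` Sub R M" "T \<in> V c R M ` Sub R M"
  then obtain N L where "N \<in> Sub R M" "S = V c R M N" "L \<in> Sub R M" "T = V c R M L" by blast
  moreover from this have "generated_sub R M (N \<union> L) \<in> Sub R M"
    by (intro generated_sub_in_Sub) (auto simp: Sub_def)
  ultimately show "S \<inter> T \<in> V c R M ` Sub R M"
    using V_Int_V by blast
qed

lemma closed_basis_closedin:
  assumes "A \<in> closed_basis c R M"
  shows "closedin (subsemimodule_space c R M) A"
proof -
  have "A \<subseteq> Dis c R M"
    using assms by (auto simp: closed_basis_def finite_unions_def V_def)
  then show ?thesis
    using assms unfolding closedin_subsemimodule_space by (intro exI[of _ "{A}"]) auto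
qed

lemma clopen_in_closed_basis_of_space:
  assumes "compact_space (subsemimodule_space c R M)"
    and "openin (subsemimodule_space c R M) C" and "closedin (subsemimodule_space c R M) C"
  shows "C \<in> closed_basis c R M"
  by (rule clopen_in_closed_basis[OF assms])
    (simp_all add: closed_basis_closedin closed_basis_Int topspace_subsemimodule_space
      Dis_in_closed_basis flip: closedin_subsemimodule_space)

end

theorem theorem3p16:
  fixes R :: "('r, 'x) ring_scheme" and M :: "('r, 'm, 'y) module_scheme" and c :: sub_class
  assumes "semimodule R M"
    and "compact_space (subsemimodule_space c R M)"
  shows "\<not> connected_space (subsemimodule_space c R M) \<longleftrightarrow>
         strongly_disconnects (closed_basis c R M) (subsemimodule_space c R M)"
proof
  let ?X = "subsemimodule_space c R M"
  interpret semimodule R M by fact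
  {
    assume "\<not> connected_space ?X"
    then obtain A B where AB: "openin ?X A" "openin ?X B" "A \<noteq> {}" "B \<noteq> {}"
      "topspace ?X \<subseteq> A \<union> B" "A \<inter> B = {}"
      unfolding connected_space_def by blast
    have sub: "A \<subseteq> topspace ?X" "B \<subseteq> topspace ?X"
      using AB(1,2) by (simp_all add: openin_subset)
    have "topspace ?X - A = B" "topspace ?X - B = A"
      using AB(5,6) sub by auto
    then have "closedin ?X A" "closedin ?X B"
      using AB(1,2) sub by (simp_all add: closedin_def)
    then have "A \<in> closed_basis c R M" "B \<in> closed_basis c R M"
      using AB(1,2) assms(2) by (simp_all add: clopen_in_closed_basis_of_space)
    moreover have "topspace ?X = A \<union> B"
      using AB(5) sub by auto
    ultimately show "strongly_disconnects (closed_basis c R M) ?X"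
      using AB(3,4,6) unfolding strongly_disconnects_def by blast
  next
    assume "strongly_disconnects (closed_basis c R M) ?X"
    then obtain A B where "A \<in> closed_basis c R M" "B \<in> closed_basis c R M"
      "A \<noteq> {}" "B \<noteq> {}" "topspace ?X = A \<union> B" "A \<inter> B = {}"
      unfolding strongly_disconnects_def by blast
    then show "\<not> connected_space ?X"
      using closed_basis_closedin unfolding connected_space_closedin by (metis order_refl)
  }
qed

end
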